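(* Let $n>1$ be an integer and let $f:\mathbb{Z}\to\mathbb{C}$ be a function satisfying the following conditions. (i) $f(i)=f(j)$ whenever $i\equiv j \pmod n$. (ii) There exist an integer $s\in\mathbb{Z}$ and a primitive $n$-th root of unity $\zeta\in\mathbb{C}$ such that $\sum_{k=0}^{n-1}f(k)\zeta^{-ks}=0$; fix such $s$ and $\zeta$. (iii) For all $i,j\in\{1,2,\dots,n\}$, $$\sum_{k=1}^{n}f(i-k)\overline{f(j-k)}=\sum_{k=1}^{n}\overline{f(k-i)}\,f(k-j).$$ Let $M=(f(i-k))_{1\le i,k\le n}$. For $j\in\{1,\dots,n\}$, let $M_j$ be the $(n-1)\times(n-1)$ matrix obtained from $M$ by deleting its $j$-th row and $j$-th column. Then for every $j\in\{1,\dots,n\}$, $$\det M_j=\frac{1}{n}\prod_{\substack{1\le i\le n\\ i\not\equiv s\ (\mathrm{mod}\ n)}}\lambda_i(M),$$ where $(\lambda_i(M))_{1\le i\le n}$ are the eigenvalues of $M$, given by $$\lambda_i(M)=\sum_{k=0}^{n-1}f(k)\zeta^{-ki},\qquad 1\le i\le n.$$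
   Context: $\overline{a}$ denotes the complex conjugate of $a\in\mathbb{C}$. The eigenvalues of $M$ are listed with multiplicity. *)

theory Defs
  imports
    "HOL-Number_Theory.Cong"
    "Jordan_Normal_Form.Determinant"
    "Jordan_Normal_Form.Char_Poly"
begin

definition primitive_unity_root :: "nat \<Rightarrow> complex \<Rightarrow> bool" where
  "primitive_unity_root n z \<longleftrightarrow> n > 0 \<and> z ^ n = 1 \<and> (\<forall>m. 0 < m \<and> m < n \<longrightarrow> z ^ m \<noteq> 1)"

(* Matrices are indexed from 0, so position (i, k) here is the entry in row i + 1 and column k + 1. *)
definition toeplitz_mat :: "nat \<Rightarrow> (int \<Rightarrow> complex) \<Rightarrow> complex mat" where
  "toeplitz_mat n f = mat n n (\<lambda>(i, k). f ((int i + 1) - (int k + 1)))"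

(* Deletes the j-th row and the j-th column, counted from 1. *)
definition principal_minor_mat :: "complex mat \<Rightarrow> nat \<Rightarrow> complex mat" where
  "principal_minor_mat A j = mat_delete A (j - 1) (j - 1)"

(* The eigenvalues, each occurring as often as its algebraic multiplicity. *)
definition eigenvalue_mset :: "complex mat \<Rightarrow> complex multiset" where
  "eigenvalue_mset A = proots (char_poly A)"

definition lam :: "nat \<Rightarrow> (int \<Rightarrow> complex) \<Rightarrow> complex \<Rightarrow> int \<Rightarrow> complex" where
  "lam n f \<zeta> i = (\<Sum>k = 0..int n - 1. f k * \<zeta> powi (- (k * i)))"

end

theory Submission
  imports Defs
begin

text \<open>The matrix \<open>M\<close> is circulant, so the Fourier basis diagonalises it with eigenvalues \<open>\<lambda>\<^sub>i\<close>.
  If \<open>M = P D Q\<close> with \<open>Q = P\<^sup>-\<^sup>1\<close>, then \<open>adj M = P (adj D) Q\<close>, and for the Fourier basis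
  \<open>P\<^sub>j\<^sub>r Q\<^sub>r\<^sub>j = 1 / n\<close>. Hence every principal minor is the average of the products
  that omit one eigenvalue; as \<open>\<lambda>\<^sub>s = 0\<close>, only the product that omits \<open>\<lambda>\<^sub>s\<close> survives.\<close>

section \<open>Adjugates and principal minors of diagonalised matrices\<close>

lemma adj_mat_unique:
  fixes A B :: "'a :: idom mat"
  assumes A: "A \<in> carrier_mat n n" and B: "B \<in> carrier_mat n n"
    and AB: "A * B = det A \<cdot>\<^sub>m 1\<^sub>m n" and det: "det A \<noteq> 0"
  shows "adj_mat A = B"
proof -
  note adj = adj_mat[OF A]
  \<comment> \<open>Bracketing \<open>adj_mat A * A * B\<close> in two ways gives the same matrix;
    the nonzero factor \<open>det A\<close> then cancels entrywise in the integral domain.\<close>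
  have "det A \<cdot>\<^sub>m adj_mat A = adj_mat A * (A * B)"
    unfolding AB using adj(1) by (simp add: mult_smult_distrib[OF adj(1) one_carrier_mat])
  also have "\<dots> = (adj_mat A * A) * B"
    using assoc_mult_mat[OF adj(1) A B] by simp
  also have "\<dots> = det A \<cdot>\<^sub>m B"
    using B by (simp add: adj(3) mult_smult_assoc_mat[of _ n n])
  finally have eq: "det A \<cdot>\<^sub>m adj_mat A = det A \<cdot>\<^sub>m B" .
  show ?thesis
  proof (rule eq_matI)
    fix i j assume ij: "i < dim_row B" "j < dim_col B"
    have "(det A \<cdot>\<^sub>m adj_mat A) $$ (i, j) = (det A \<cdot>\<^sub>m B) $$ (i, j)"
      by (simp only: eq)
    then show "adj_mat A $$ (i, j) = B $$ (i, j)"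
      using ij adj(1) B det by simp
  qed (use adj(1) B in auto)
qed

definition diag_of :: "nat \<Rightarrow> (nat \<Rightarrow> 'a :: zero) \<Rightarrow> 'a mat" where
  "diag_of n d = mat n n (\<lambda>(i, j). if i = j then d i else 0)"

lemma diag_of_carrier [simp]: "diag_of n d \<in> carrier_mat n n"
  by (simp add: diag_of_def)

lemma mult_diag_of_index:
  fixes P :: "'a :: comm_ring_1 mat"
  assumes "P \<in> carrier_mat m n" "i < m" "j < n"
  shows "(P * diag_of n d) $$ (i, j) = P $$ (i, j) * d j"
  using assms by (simp add: diag_of_def scalar_prod_def if_distrib sum.delta cong: if_cong)

lemma diag_of_mult:
  "diag_of n c * diag_of n d = diag_of n (\<lambda>i. c i * d i :: 'a :: comm_ring_1)"
proof (rule eq_matI)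
  fix i j assume "i < dim_row (diag_of n (\<lambda>i. c i * d i))" "j < dim_col (diag_of n (\<lambda>i. c i * d i))"
  then have ij: "i < n" "j < n" by (auto simp: diag_of_def)
  show "(diag_of n c * diag_of n d) $$ (i, j) = diag_of n (\<lambda>i. c i * d i) $$ (i, j)"
    unfolding mult_diag_of_index[OF diag_of_carrier ij] using ij by (simp add: diag_of_def)
qed (auto simp: diag_of_def)

lemma det_diag_of: "det (diag_of n d) = (\<Prod>i<n. d i :: 'a :: comm_ring_1)"
proof -
  have "det (diag_of n d) = prod_list (diag_mat (diag_of n d))"
    by (rule det_upper_triangular[of _ n]) (auto simp: diag_of_def upper_triangular_def)
  also have "diag_mat (diag_of n d) = map d [0..<n]"
    by (auto simp: diag_mat_def diag_of_def)
  finally show ?thesis by (simp add: prod.list_conv_set_nth atLeast0LessThan)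
qed

lemma dim_row_similar_diag_of:
  assumes "similar_mat_wit A (diag_of n d) P Q"
  shows "dim_row A = n"
proof -
  have "diag_of n d \<in> carrier_mat (dim_row A) (dim_row A)"
    using similar_mat_witD(5)[OF refl assms] .
  then have "dim_row (diag_of n d) = dim_row A" by blast
  then show ?thesis by (simp add: diag_of_def)
qed

lemma adj_mat_similar_diag_of:
  fixes A :: "'a :: idom mat"
  assumes sim: "similar_mat_wit A (diag_of n c) P Q" and det: "det A \<noteq> 0"
  shows "adj_mat A = P * diag_of n (\<lambda>i. \<Prod>k\<in>{..<n} - {i}. c k) * Q"
proof (rule adj_mat_unique[of _ n])
  have dim: "dim_row A = n"
    by (rule dim_row_similar_diag_of[OF sim])
  note w = similar_mat_witD[OF dim[symmetric] sim]
  let ?C = "diag_of n c" and ?E = "diag_of n (\<lambda>i. \<Prod>k\<in>{..<n} - {i}. c k)"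
  show "A \<in> carrier_mat n n" "P * ?E * Q \<in> carrier_mat n n" using w(4-7) by auto
  have detA: "det A = (\<Prod>i<n. c i)"
    using det_similar[of A ?C] sim by (auto simp: similar_mat_def det_diag_of)
  have CE: "?C * ?E = det A \<cdot>\<^sub>m 1\<^sub>m n"
    unfolding diag_of_mult detA by (rule eq_matI) (auto simp: diag_of_def prod.remove[symmetric])
  have c: "?C \<in> carrier_mat n n" "?E \<in> carrier_mat n n" by simp_all
  note assoc = assoc_mult_mat[of _ n n _ n _ n] mult_carrier_mat[of _ n n _ n] and P = w(6) and Q = w(7)
  have "A * (P * ?E * Q) = (P * ?C * Q) * (P * (?E * Q))"
    unfolding w(3) using P Q c by (simp add: assoc)
  also have "\<dots> = P * ?C * ((Q * P) * (?E * Q))"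
    using P Q c by (simp add: assoc)
  also have "\<dots> = P * (?C * ?E) * Q"
    unfolding w(2) using P Q c by (simp add: assoc left_mult_one_mat[of _ n n])
  also have "\<dots> = det A \<cdot>\<^sub>m 1\<^sub>m n"
    unfolding CE using P Q by (simp add: mult_smult_distrib[of _ n n _ n] mult_smult_assoc_mat[of _ n n _ n] w(1))
  finally show "A * (P * ?E * Q) = det A \<cdot>\<^sub>m 1\<^sub>m n" .
qed fact

text \<open>A scalar matrix is conjugate only to itself, so the constant matrices \<open>P\<close>
  and \<open>Q\<close> still diagonalise after adding X on the diagonal. Each eigenvalue
  \<open>d i\<close> becomes the monic polynomial \<open>[:d i, 1:]\<close>, which is nonzero even
  if \<open>d i = 0\<close>; over an integral domain the new determinant is therefore
  nonzero.\<close>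

lemma similar_mat_wit_add_X:
  fixes M :: "'a :: comm_ring_1 mat"
  assumes sim: "similar_mat_wit M (diag_of n d) P Q"
  defines "h \<equiv> \<lambda>a :: 'a. [:a:]"
  shows "similar_mat_wit ([:0, 1:] \<cdot>\<^sub>m 1\<^sub>m n + map_mat h M) (diag_of n (\<lambda>i. [:d i, 1:])) (map_mat h P) (map_mat h Q)"
proof -
  let ?P = "map_mat h P" and ?Q = "map_mat h Q" and ?D = "diag_of n d" and ?XI = "[:0, 1:] \<cdot>\<^sub>m 1\<^sub>m n"
  have dim: "dim_row M = n"
    by (rule dim_row_similar_diag_of[OF sim])
  note w = similar_mat_witD[OF dim[symmetric] sim]
  have c: "?P \<in> carrier_mat n n" "?Q \<in> carrier_mat n n" "map_mat h ?D \<in> carrier_mat n n"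
    using w(4-7) by auto
  have h1: "map_mat h (1\<^sub>m n) = 1\<^sub>m n"
    by (rule eq_matI) (auto simp: h_def one_pCons)
  have PQ: "?P * ?Q = 1\<^sub>m n"
    using map_poly_mult(1)[OF w(6,7)] w(1) h1 by (simp add: h_def)
  have QP: "?Q * ?P = 1\<^sub>m n"
    using map_poly_mult(1)[OF w(7,6)] w(2) h1 by (simp add: h_def)
  have "map_mat h (P * ?D * Q) = ?P * map_mat h ?D * ?Q"
    unfolding h_def using map_poly_mult(1)[OF mult_carrier_mat[OF w(6,5)] w(7)] map_poly_mult(1)[OF w(6,5)] by simp
  then have M: "map_mat h M = ?P * map_mat h ?D * ?Q"
    using w(3) by simp
  have X: "?XI = ?P * ?XI * ?Q"
    using c by (simp add: mult_smult_distrib[of _ n n _ n] mult_smult_assoc_mat[of _ n n _ n] PQ)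
  have D: "diag_of n (\<lambda>i. [:d i, 1:]) = ?XI + map_mat h ?D"
    by (rule eq_matI) (auto simp: diag_of_def h_def)
  have "?XI + map_mat h M = (?P * ?XI + ?P * map_mat h ?D) * ?Q"
    unfolding M using c X by (subst add_mult_distrib_mat[of _ n n _ _ n]) auto
  also have "?P * ?XI + ?P * map_mat h ?D = ?P * diag_of n (\<lambda>i. [:d i, 1:])"
    unfolding D using c by (intro mult_add_distrib_mat[symmetric, of _ n n]) auto
  finally show ?thesis
    using c w(4) by (intro similar_mat_witI[OF PQ QP]) auto
qed

lemma prod_pCons_ne_0: "(\<Prod>i\<in>A. [:d i, 1 :: 'a :: idom:]) \<noteq> 0"
  by (cases "finite A") (auto simp: prod_zero_iff)

text \<open>The adjugate of a diagonalised matrix is only accessible when the determinant is nonzero.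
  Passing to \<open>M + X \<cdot> 1\<close> over the polynomial ring and evaluating at \<open>X = 0\<close> covers singular \<open>M\<close>.\<close>

lemma det_principal_minor_similar_diag_of:
  fixes M :: "'a :: idom mat"
  assumes sim: "similar_mat_wit M (diag_of n d) P Q" and j: "j < n"
  shows "det (mat_delete M j j) = (\<Sum>r<n. P $$ (j, r) * Q $$ (r, j) * (\<Prod>k\<in>{..<n} - {r}. d k))"
proof -
  define h where "h = (\<lambda>a :: 'a. [:a:])"
  define A where "A = [:0, 1:] \<cdot>\<^sub>m 1\<^sub>m n + map_mat h M"
  define e where "e = (\<lambda>r. \<Prod>k\<in>{..<n} - {r}. [:d k, 1:])"
  have dim: "dim_row M = n"
    by (rule dim_row_similar_diag_of[OF sim])
  note w = similar_mat_witD[OF dim[symmetric] sim]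
  have simA: "similar_mat_wit A (diag_of n (\<lambda>i. [:d i, 1:])) (map_mat h P) (map_mat h Q)"
    unfolding A_def h_def by (rule similar_mat_wit_add_X[OF sim])
  have A: "A \<in> carrier_mat n n" using w(4) by (simp add: A_def)
  have "det A = (\<Prod>i<n. [:d i, 1:])"
    using det_similar[of A] simA det_diag_of unfolding similar_mat_def by metis
  then have "det A \<noteq> 0" using prod_pCons_ne_0 by metis
  then have adj: "adj_mat A = map_mat h P * diag_of n e * map_mat h Q"
    using adj_mat_similar_diag_of[OF simA] by (simp add: e_def)
  \<comment> \<open>A diagonal entry of the adjugate is the principal minor itself, since the
    cofactor sign is (-1)^(j+j) = 1.\<close>
  have "det (mat_delete A j j) = adj_mat A $$ (j, j)"
    using A j by (simp add: adj_mat_def cofactor_def)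
  also have "\<dots> = (\<Sum>r<n. (map_mat h P * diag_of n e) $$ (j, r) * map_mat h Q $$ (r, j))"
    unfolding adj using w(6,7) j by (simp add: scalar_prod_def atLeast0LessThan diag_of_def)
  also have "\<dots> = (\<Sum>r<n. h (P $$ (j, r)) * e r * h (Q $$ (r, j)))"
    using w(6,7) j by (intro sum.cong) (auto simp: mult_diag_of_index[of _ n])
  finally have eq: "det (mat_delete A j j) = (\<Sum>r<n. h (P $$ (j, r)) * e r * h (Q $$ (r, j)))" .
  \<comment> \<open>Evaluation at 0 is a ring homomorphism, so it commutes with \<open>det\<close>;
    on the entries it removes the added X and returns the minor of \<open>M\<close>.\<close>
  have ev: "comm_ring_hom (\<lambda>p. poly p (0 :: 'a))" by unfold_locales auto
  have "map_mat (\<lambda>p. poly p 0) (mat_delete A j j) = mat_delete M j j"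
    using w(4) by (intro eq_matI) (auto simp: A_def h_def mat_delete_def)
  then have "det (mat_delete M j j) = poly (det (mat_delete A j j)) 0"
    using comm_ring_hom.hom_det[OF ev, of "mat_delete A j j"] by simp
  also have "\<dots> = (\<Sum>r<n. P $$ (j, r) * Q $$ (r, j) * (\<Prod>k\<in>{..<n} - {r}. d k))"
    unfolding eq by (simp add: h_def e_def poly_sum poly_prod ac_simps)
  finally show ?thesis .
qed

section \<open>Eigenvalues of diagonalised matrices\<close>

lemma char_poly_similar_diag_of:
  fixes M :: "'a :: comm_ring_1 mat"
  assumes "similar_mat_wit M (diag_of n d) P Q"
  shows "char_poly M = (\<Prod>i<n. [:- d i, 1:])"
proof -
  have "char_poly M = char_poly (diag_of n d)"
    using assms by (intro char_poly_similar) (auto simp: similar_mat_def)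
  also have "\<dots> = (\<Prod>a\<leftarrow>diag_mat (diag_of n d). [:- a, 1:])"
    by (rule char_poly_upper_triangular[of _ n]) (auto simp: diag_of_def upper_triangular_def)
  also have "diag_mat (diag_of n d) = map d [0..<n]"
    by (auto simp: diag_mat_def diag_of_def)
  finally show ?thesis by (simp add: prod.list_conv_set_nth atLeast0LessThan)
qed

lemma eigenvalue_mset_similar_diag_of:
  assumes "similar_mat_wit M (diag_of n d) P Q"
  shows "eigenvalue_mset M = image_mset d (mset_set {..<n})"
  unfolding eigenvalue_mset_def char_poly_similar_diag_of[OF assms]
  by (subst proots_prod) (auto simp: sum_unfold_sum_mset)

section \<open>Roots of unity and the Fourier basis\<close>

lemma sum_cong_mod_residues:
  fixes g :: "int \<Rightarrow> 'a :: comm_monoid_add"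
  assumes n: "n > 0" and g: "\<And>i j. [i = j] (mod int n) \<Longrightarrow> g i = g j"
  shows "(\<Sum>k<n. g (i - int k)) = (\<Sum>k = 0..int n - 1. g k)"
\<comment> \<open>Reflection k -> i - k is an involution on residues mod n, so both witnesses use
  the same formula and differ only in the type of the index.\<close>
proof (rule sum.reindex_bij_witness[where j = "\<lambda>k. (i - int k) mod int n" and i = "\<lambda>m. nat ((i - m) mod int n)"])
  fix k assume "k \<in> {..<n}"
  then have "(i - (i - int k) mod int n) mod int n = int k"
    by (simp add: mod_diff_right_eq)
  then show "nat ((i - (i - int k) mod int n) mod int n) = k" by simp
  show "(i - int k) mod int n \<in> {0..int n - 1}" using n by simp
  show "g ((i - int k) mod int n) = g (i - int k)" by (rule g) (simp add: cong_def)
next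
  fix m assume m: "m \<in> {0..int n - 1}"
  then show "(i - int (nat ((i - m) mod int n))) mod int n = m"
    using n by (simp add: mod_diff_right_eq)
  show "nat ((i - m) mod int n) \<in> {..<n}" using n by (simp add: nat_less_iff)
qed

lemma primitive_unity_root_ne_0: "primitive_unity_root n z \<Longrightarrow> z \<noteq> 0"
  by (auto simp: primitive_unity_root_def power_0_left)

lemma primitive_unity_root_powi_cong:
  assumes z: "primitive_unity_root n z" and ij: "[i = j] (mod int n)"
  shows "z powi i = z powi j"
proof -
  obtain k where "i = j + int n * k"
    using ij by (metis cong_iff_lin cong_sym)
  then show ?thesis
    using z primitive_unity_root_ne_0[OF z]
    by (simp add: primitive_unity_root_def power_int_add power_int_mult)
qed

text \<open>The exponent may be reduced to its residue in [0, n), where minimality of n leaves only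
  0.\<close>

lemma primitive_unity_root_powi_eq_1:
  assumes z: "primitive_unity_root n z" and i: "z powi i = 1"
  shows "int n dvd i"
proof -
  have n: "n > 0" using z by (simp add: primitive_unity_root_def)
  have "z ^ nat (i mod int n) = z powi (i mod int n)"
    using n by (simp add: power_int_nonneg_exp)
  also have "\<dots> = 1"
    using primitive_unity_root_powi_cong[OF z, of "i mod int n" i] i by (simp add: cong_def)
  finally have "\<not> (0 < nat (i mod int n) \<and> nat (i mod int n) < n)"
    using z by (auto simp: primitive_unity_root_def)
  moreover have "nat (i mod int n) < n" "i mod int n \<ge> 0" using n by (auto simp: nat_less_iff)
  ultimately show ?thesis by (auto simp: dvd_eq_mod_eq_0)
qed

text \<open>This is orthogonality of characters, a geometric sum with ratio \<open>z powi m\<close>.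
  The ratio is 1 exactly when n divides m; otherwise its n-th power being 1 annihilates the sum. The
  shift \<open>r + 1\<close> matches the eigenvalue indices 1..n and contributes only one extra
  factor.\<close>

lemma sum_primitive_unity_root_powi:
  assumes z: "primitive_unity_root n z"
  shows "(\<Sum>r<n. z powi (m * int (r + 1))) = (if int n dvd m then of_nat n else 0)"
proof -
  let ?w = "z powi m"
  have pow: "z powi (m * int (r + 1)) = ?w * ?w ^ r" for r
    unfolding power_int_mult power_int_of_nat by simp
  have sum: "(\<Sum>r<n. z powi (m * int (r + 1))) = ?w * (\<Sum>r<n. ?w ^ r)"
    by (simp only: pow sum_distrib_left)
  have wn: "?w ^ n = 1"
    using primitive_unity_root_powi_cong[OF z, of "m * int n" 0]
    by (simp add: power_int_power' cong_def)
  show ?thesis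
  proof (cases "int n dvd m")
    case True
    then have "?w = 1"
      using primitive_unity_root_powi_cong[OF z, of m 0] by (simp add: cong_0_iff)
    then show ?thesis using True unfolding sum by simp
  next
    case False
    then have "?w \<noteq> 1" using primitive_unity_root_powi_eq_1[OF z] by blast
    then show ?thesis using False wn unfolding sum by (simp add: geometric_sum)
  qed
qed

text \<open>The columns of \<open>?P\<close> are the characters of Z/n. By periodicity
  \<open>?M\<close> acts as cyclic convolution with \<open>f\<close>, and convolution multiplies a
  character by the corresponding Fourier coefficient \<open>lam\<close>. Orthogonality of characters
  makes \<open>?Q\<close>, the conjugate transpose of \<open>?P\<close> divided by n, its
  inverse.\<close>

lemma similar_mat_wit_toeplitz_mat:
  assumes f: "\<And>i j. [i = j] (mod int n) \<Longrightarrow> f i = f j" and z: "primitive_unity_root n z"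
  shows "similar_mat_wit (toeplitz_mat n f) (diag_of n (\<lambda>r. lam n f z (int (r + 1))))
    (mat n n (\<lambda>(i, r). z powi (int i * int (r + 1))))
    (mat n n (\<lambda>(r, i). z powi (- (int i * int (r + 1))) / of_nat n))"
    (is "similar_mat_wit ?M ?D ?P ?Q")
proof -
  have n: "n > 0" using z by (simp add: primitive_unity_root_def)
  have z0: "z \<noteq> 0" by (rule primitive_unity_root_ne_0[OF z])
  have c: "?M \<in> carrier_mat n n" "?P \<in> carrier_mat n n" "?Q \<in> carrier_mat n n" "?D \<in> carrier_mat n n"
    by (auto simp: toeplitz_mat_def)
  have PQ: "?P * ?Q = 1\<^sub>m n"
  proof (rule eq_matI)
    fix i j assume "i < dim_row (1\<^sub>m n :: complex mat)" "j < dim_col (1\<^sub>m n :: complex mat)"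
    then have ij: "i < n" "j < n" by auto
    have "(?P * ?Q) $$ (i, j) = (\<Sum>r<n. z powi (int i * int (r + 1)) * (z powi (- (int j * int (r + 1))) / of_nat n))"
      using ij by (simp add: scalar_prod_def atLeast0LessThan)
    also have "\<dots> = (\<Sum>r<n. z powi ((int i - int j) * int (r + 1))) / of_nat n"
      unfolding sum_divide_distrib
      by (intro sum.cong refl) (simp add: z0 power_int_add[symmetric] algebra_simps)
    also have "\<dots> = (if int n dvd int i - int j then 1 else 0)"
      using n by (simp only: sum_primitive_unity_root_powi[OF z]) simp
    \<comment> \<open>Both indices lie in [0, n), so congruence forces equality.\<close>
    also have "int n dvd int i - int j \<longleftrightarrow> i = j"
      using ij by (metis cong_iff_dvd_diff cong_int_iff cong_less_modulus_unique_nat cong_refl)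
    finally show "(?P * ?Q) $$ (i, j) = (1\<^sub>m n :: complex mat) $$ (i, j)" using ij by simp
  qed auto
  have QP: "?Q * ?P = 1\<^sub>m n"
    by (rule mat_mult_left_right_inverse[OF c(2,3) PQ])
  have MP: "?M * ?P = ?P * ?D"
  proof (rule eq_matI)
    fix i r assume "i < dim_row (?P * ?D)" "r < dim_col (?P * ?D)"
    then have ir: "i < n" "r < n" by (auto simp: diag_of_def)
    define g where "g = (\<lambda>m. f m * z powi (- (m * int (r + 1))))"
    have g: "g a = g b" if "[a = b] (mod int n)" for a b
      unfolding g_def using f[OF that] that
      by (intro arg_cong2[where f = "(*)"] primitive_unity_root_powi_cong[OF z])
         (auto intro: cong_mult simp: cong_minus_minus_iff)
    have "(?M * ?P) $$ (i, r) = (\<Sum>k<n. f (int i - int k) * z powi (int k * int (r + 1)))"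
      using ir by (simp add: toeplitz_mat_def scalar_prod_def atLeast0LessThan)
    \<comment> \<open>Writing k = i - (i - k) in the exponent pulls out the character value at i and
      leaves an n-periodic summand in i - k.\<close>
    also have "\<dots> = z powi (int i * int (r + 1)) * (\<Sum>k<n. g (int i - int k))"
      unfolding sum_distrib_left g_def
      by (intro sum.cong refl) (simp add: z0 power_int_add[symmetric] algebra_simps)
    also have "(\<Sum>k<n. g (int i - int k)) = (\<Sum>k = 0..int n - 1. g k)"
      by (rule sum_cong_mod_residues[OF n]) (rule g)
    also have "\<dots> = lam n f z (int (r + 1))" by (simp add: g_def lam_def)
    also have "z powi (int i * int (r + 1)) * lam n f z (int (r + 1)) = (?P * ?D) $$ (i, r)"
      using mult_diag_of_index[OF c(2) ir] ir by simp
    finally show "(?M * ?P) $$ (i, r) = (?P * ?D) $$ (i, r)" .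
  qed (auto simp: toeplitz_mat_def diag_of_def)
  have "?M = ?M * (?P * ?Q)" unfolding PQ using c(1) by simp
  also have "\<dots> = ?P * ?D * ?Q"
    unfolding MP[symmetric] by (rule assoc_mult_mat[OF c(1,2,3), symmetric])
  finally show ?thesis using c by (intro similar_mat_witI[OF PQ QP]) auto
qed

section \<open>Spectrum and principal minors of the circulant matrix\<close>

theorem theorem2p1:
  fixes n :: nat and f :: "int \<Rightarrow> complex" and s :: int and \<zeta> :: complex
  assumes "n > 1"
    and "\<And>i j. [i = j] (mod int n) \<Longrightarrow> f i = f j"
    and "primitive_unity_root n \<zeta>"
    and "(\<Sum>k = 0..int n - 1. f k * \<zeta> powi (- (k * s))) = 0"
    and "\<And>i j. i \<in> {1..int n} \<Longrightarrow> j \<in> {1..int n} \<Longrightarrow>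
      (\<Sum>k = 1..int n. f (i - k) * cnj (f (j - k))) = (\<Sum>k = 1..int n. cnj (f (k - i)) * f (k - j))"
  shows "eigenvalue_mset (toeplitz_mat n f) = image_mset (lam n f \<zeta>) (mset_set {1..int n}) \<and>
    (\<forall>j\<in>{1..n}. det (principal_minor_mat (toeplitz_mat n f) j) =
      1 / of_nat n * (\<Prod>i\<in>{i\<in>{1..int n}. \<not> [i = s] (mod int n)}. lam n f \<zeta> i))"
proof (intro conjI ballI)
  define d where "d = (\<lambda>r. lam n f \<zeta> (int (r + 1)))"
  have n: "n > 0" using assms(1) by simp
  have z0: "\<zeta> \<noteq> 0" by (rule primitive_unity_root_ne_0[OF assms(3)])
  have sim: "similar_mat_wit (toeplitz_mat n f) (diag_of n d)
    (mat n n (\<lambda>(i, r). \<zeta> powi (int i * int (r + 1))))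
    (mat n n (\<lambda>(r, i). \<zeta> powi (- (int i * int (r + 1))) / of_nat n))"
    unfolding d_def by (rule similar_mat_wit_toeplitz_mat[OF _ assms(3)]) (rule assms(2))
  have bij: "bij_betw (\<lambda>r. int (r + 1)) {..<n} {1..int n}"
    by (rule bij_betwI[where g = "\<lambda>i. nat (i - 1)"]) auto
  have "eigenvalue_mset (toeplitz_mat n f) = image_mset d (mset_set {..<n})"
    by (rule eigenvalue_mset_similar_diag_of[OF sim])
  also have "\<dots> = image_mset (lam n f \<zeta>) (image_mset (\<lambda>r. int (r + 1)) (mset_set {..<n}))"
    by (simp add: d_def multiset.map_comp o_def)
  also have "image_mset (\<lambda>r. int (r + 1)) (mset_set {..<n}) = mset_set {1..int n}"
    using bij by (simp only: image_mset_mset_set bij_betw_def)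
  finally show "eigenvalue_mset (toeplitz_mat n f) = image_mset (lam n f \<zeta>) (mset_set {1..int n})" .

  fix j assume j: "j \<in> {1..n}"
  \<comment> \<open>Since s is an arbitrary integer, it is first reduced mod n; the subtraction of 1
    converts the index range 1..n to 0..n-1.\<close>
  define r\<^sub>0 where "r\<^sub>0 = nat ((s - 1) mod int n)"
  have r0: "r\<^sub>0 < n" using n by (simp add: r\<^sub>0_def nat_less_iff)
  have r0_iff: "[int (r + 1) = s] (mod int n) \<longleftrightarrow> r = r\<^sub>0" if "r < n" for r
  proof -
    have "[int (r + 1) = s] (mod int n) \<longleftrightarrow> [int r = s - 1] (mod int n)"
      by (simp add: cong_iff_dvd_diff algebra_simps)
    also have "\<dots> \<longleftrightarrow> int r = (s - 1) mod int n"
      using that by (simp add: cong_def)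
    finally show ?thesis using n by (auto simp: r\<^sub>0_def)
  qed
  \<comment> \<open>The value \<open>lam n f \<zeta> i\<close> depends only on i mod n, because
    powers of \<zeta> do; this carries the vanishing at s over to an index in range.\<close>
  have "d r\<^sub>0 = lam n f \<zeta> s"
    unfolding d_def lam_def using r0_iff[OF r0]
    by (intro sum.cong refl arg_cong2[where f = "(*)"] primitive_unity_root_powi_cong[OF assms(3)])
       (auto intro: cong_mult simp: cong_minus_minus_iff)
  then have d0: "d r\<^sub>0 = 0" using assms(4) by (simp add: lam_def)
  \<comment> \<open>These are the products of the (j, r) entry of P and the (r, j) entry of Q, with
    row j counted from 0. The two powers are inverse to each other, so each product is 1/n,
    independently of j and r.\<close>
  let ?c = "\<lambda>r. \<zeta> powi (int (j - 1) * int (r + 1)) * (\<zeta> powi (- (int (j - 1) * int (r + 1))) / of_nat n)"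
  have "det (principal_minor_mat (toeplitz_mat n f) j) = (\<Sum>r<n. ?c r * (\<Prod>k\<in>{..<n} - {r}. d k))"
    unfolding principal_minor_mat_def
    using j by (subst det_principal_minor_similar_diag_of[OF sim]) auto
  also have "\<dots> = (\<Sum>r<n. 1 / of_nat n * (\<Prod>k\<in>{..<n} - {r}. d k))"
    using z0 by (intro sum.cong refl) (simp add: power_int_minus)
  \<comment> \<open>For every other r the product still contains the zero factor at
    \<open>r\<^sub>0\<close>.\<close>
  also have "\<dots> = (\<Sum>r\<in>{r\<^sub>0}. 1 / of_nat n * (\<Prod>k\<in>{..<n} - {r}. d k))"
    using r0 d0 by (intro sum.mono_neutral_right) (auto intro!: bexI[of _ r\<^sub>0])
  also have "(\<Sum>r\<in>{r\<^sub>0}. 1 / of_nat n * (\<Prod>k\<in>{..<n} - {r}. d k)) = 1 / of_nat n * (\<Prod>k\<in>{..<n} - {r\<^sub>0}. d k)"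
    by simp
  \<comment> \<open>By \<open>r0_iff\<close>, shifting the index by 1 turns the omission of
    \<open>r\<^sub>0\<close> into the omission of the residue class of s.\<close>
  also have "(\<Prod>k\<in>{..<n} - {r\<^sub>0}. d k) = (\<Prod>i\<in>{i\<in>{1..int n}. \<not> [i = s] (mod int n)}. lam n f \<zeta> i)"
  proof (rule prod.reindex_bij_witness[where j = "\<lambda>r. int (r + 1)" and i = "\<lambda>i. nat (i - 1)"])
    fix i assume i: "i \<in> {i\<in>{1..int n}. \<not> [i = s] (mod int n)}"
    then show "nat (i - 1) \<in> {..<n} - {r\<^sub>0}"
      using r0_iff[of "nat (i - 1)"] n by (auto simp: nat_less_iff)
    show "int (nat (i - 1) + 1) = i" using i by auto
  qed (use r0_iff in \<open>auto simp: d_def\<close>)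
  finally show "det (principal_minor_mat (toeplitz_mat n f) j) =
      1 / of_nat n * (\<Prod>i\<in>{i\<in>{1..int n}. \<not> [i = s] (mod int n)}. lam n f \<zeta> i)" .
qed

end
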